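(* If $\pi$ is a $312$-avoiding permutation, then $\operatorname{diam}(G_{\pi})=|L_2(\pi)|$.
   Context: A permutation avoids $312$ if no subsequence of its one-line notation is order isomorphic to $312$. For $\pi\in\mathfrak S_n$, an inversion is a pair $(i,j)$ with $i<j$ and $\pi_i>\pi_j$. $I_2(\pi)$ is the set of unordered pairs of disjoint inversions $\{(i,j),(k,l)\}$ (i.e. $\{i,j\}\cap\{k,l\}=\emptyset$), $I_3(\pi)$ is the set of triples of inversions $((i,j),(i,k),(j,k))$ with $i<j<k$ (equivalently, occurrences of the pattern $321$), and $|L_2(\pi)|:=|I_2(\pi)|+|I_3(\pi)|$. $R(\pi)$ is the set of reduced words of $\pi$ (minimal-length words $r_1\cdots r_\ell$ in $[n-1]$ with $\pi=s_{r_1}\cdots s_{r_\ell}$, $s_i=(i,i+1)$); $G_\pi$ is the graph on $R(\pi)$ whose edges join words related by one commutation move (exchange adjacent $jk$ with $|j-k|>1$) or one long braid move (replace consecutive $j(j+1)j$ by $(j+1)j(j+1)$ or vice versa). Diameter = maximum distance between two vertices. *)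

theory Defs
  imports
    "HOL-Combinatorics.Permutations"
    "Graph_Theory.Graph_Theory"
begin

text \<open>
  Elements of \<open>\<SS>\<^sub>n\<close> are functions \<open>p :: nat \<Rightarrow> nat\<close> with \<open>p permutes {1..n}\<close>; the one-line
  notation of \<open>p\<close> is \<open>p 1, \<dots>, p n\<close>. Patterns are given by their one-line notation as lists.
\<close>

definition contains_pattern :: "nat \<Rightarrow> (nat \<Rightarrow> nat) \<Rightarrow> nat list \<Rightarrow> bool" where
  "contains_pattern n p \<sigma> \<longleftrightarrow>
     (\<exists>ps. length ps = length \<sigma> \<and> sorted_wrt (<) ps \<and> set ps \<subseteq> {1..n} \<and>
       (\<forall>a<length \<sigma>. \<forall>b<length \<sigma>. p (ps ! a) < p (ps ! b) \<longleftrightarrow> \<sigma> ! a < \<sigma> ! b))"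

definition avoids_pattern :: "nat \<Rightarrow> (nat \<Rightarrow> nat) \<Rightarrow> nat list \<Rightarrow> bool" where
  "avoids_pattern n p \<sigma> \<longleftrightarrow> \<not> contains_pattern n p \<sigma>"

definition inversions :: "nat \<Rightarrow> (nat \<Rightarrow> nat) \<Rightarrow> (nat \<times> nat) set" where
  "inversions n p = {(i, j). i \<in> {1..n} \<and> j \<in> {1..n} \<and> i < j \<and> p i > p j}"

definition I2 :: "nat \<Rightarrow> (nat \<Rightarrow> nat) \<Rightarrow> (nat \<times> nat) set set" where
  "I2 n p = {{(i, j), (k, l)} | i j k l.
     (i, j) \<in> inversions n p \<and> (k, l) \<in> inversions n p \<and> {i, j} \<inter> {k, l} = {}}"

definition I3 :: "nat \<Rightarrow> (nat \<Rightarrow> nat) \<Rightarrow> ((nat \<times> nat) \<times> (nat \<times> nat) \<times> (nat \<times> nat)) set" where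
  "I3 n p = {((i, j), (i, k), (j, k)) | i j k. i < j \<and> j < k \<and>
     (i, j) \<in> inversions n p \<and> (i, k) \<in> inversions n p \<and> (j, k) \<in> inversions n p}"

definition card_L2 :: "nat \<Rightarrow> (nat \<Rightarrow> nat) \<Rightarrow> nat" where
  "card_L2 n p = card (I2 n p) + card (I3 n p)"

text \<open>The product \<open>s\<^bsub>r 1\<^esub> \<cdots> s\<^bsub>r l\<^esub>\<close> is composition of functions (rightmost factor first).\<close>

definition word_perm :: "nat list \<Rightarrow> nat \<Rightarrow> nat" where
  "word_perm w = foldr (\<lambda>r f. transpose r (r + 1) \<circ> f) w id"

definition words_for :: "nat \<Rightarrow> (nat \<Rightarrow> nat) \<Rightarrow> nat list set" where
  "words_for n p = {w. set w \<subseteq> {1..<n} \<and> word_perm w = p}"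

definition reduced_words :: "nat \<Rightarrow> (nat \<Rightarrow> nat) \<Rightarrow> nat list set" where
  "reduced_words n p = {w \<in> words_for n p. \<forall>v \<in> words_for n p. length w \<le> length v}"

definition commutation_move :: "nat list \<Rightarrow> nat list \<Rightarrow> bool" where
  "commutation_move u v \<longleftrightarrow>
     (\<exists>x y j k. \<bar>int j - int k\<bar> > 1 \<and> u = x @ [j, k] @ y \<and> v = x @ [k, j] @ y)"

definition braid_move :: "nat list \<Rightarrow> nat list \<Rightarrow> bool" where
  "braid_move u v \<longleftrightarrow>
     (\<exists>x y j. u = x @ [j, j + 1, j] @ y \<and> v = x @ [j + 1, j, j + 1] @ y \<or>
              u = x @ [j + 1, j, j + 1] @ y \<and> v = x @ [j, j + 1, j] @ y)"

text \<open>An undirected graph is represented by a symmetric digraph.\<close>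

definition reduced_word_graph :: "nat \<Rightarrow> (nat \<Rightarrow> nat) \<Rightarrow> nat list pair_pre_digraph" where
  "reduced_word_graph n p =
     \<lparr> pverts = reduced_words n p,
       parcs = {(u, v). u \<in> reduced_words n p \<and> v \<in> reduced_words n p \<and>
                        (commutation_move u v \<or> braid_move u v)} \<rparr>"

text \<open>
  Distances are shortest-path costs for unit arc weights, so they are \<open>\<infinity>\<close> between vertices in
  different components; in particular a finite diameter includes connectedness.
\<close>

definition diam :: "('a, 'b) pre_digraph \<Rightarrow> ereal" where
  "diam G = (SUP u\<in>verts G. SUP v\<in>verts G. wf_digraph.\<mu> G (\<lambda>_. 1) u v)"

lemma commutation_move_sym:
  assumes "commutation_move u v"
  shows "commutation_move v u"
proof -
  obtain x y j k where *: "\<bar>int j - int k\<bar> > 1" "u = x @ [j, k] @ y" "v = x @ [k, j] @ y"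
    using assms unfolding commutation_move_def by blast
  then have "\<bar>int k - int j\<bar> > 1" by linarith
  with *(2,3) show ?thesis unfolding commutation_move_def by blast
qed

lemma braid_move_sym:
  assumes "braid_move u v"
  shows "braid_move v u"
proof -
  obtain x y j where
    "u = x @ [j, j + 1, j] @ y \<and> v = x @ [j + 1, j, j + 1] @ y \<or>
     u = x @ [j + 1, j, j + 1] @ y \<and> v = x @ [j, j + 1, j] @ y"
    using assms unfolding braid_move_def by blast
  then show ?thesis
    unfolding braid_move_def by (intro exI[of _ x] exI[of _ y] exI[of _ j]) argo
qed

lemma commutation_move_irrefl: "\<not> commutation_move u u"
  by (auto simp: commutation_move_def)

lemma braid_move_irrefl: "\<not> braid_move u u"
  by (auto simp: braid_move_def)

lemma pair_bidirected_reduced_word_graph: "pair_bidirected_digraph (reduced_word_graph n p)"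
proof
  show "symmetric (reduced_word_graph n p)"
    unfolding symmetric_def
  proof (rule symI)
    fix u v assume "(u, v) \<in> arcs_ends (with_proj (reduced_word_graph n p))"
    then show "(v, u) \<in> arcs_ends (with_proj (reduced_word_graph n p))"
      using commutation_move_sym[of u v] braid_move_sym[of u v]
      by (simp add: reduced_word_graph_def) argo
  qed
next
  fix e assume e: "e \<in> parcs (reduced_word_graph n p)"
  show "fst e \<in> pverts (reduced_word_graph n p)" "snd e \<in> pverts (reduced_word_graph n p)"
    using e by (simp_all add: reduced_word_graph_def split_beta)
  show "fst e \<noteq> snd e"
    using e commutation_move_irrefl[of "fst e"] braid_move_irrefl[of "fst e"]
    by (simp add: reduced_word_graph_def split_beta) metis
qed

end

theory Submission
  imports Defs
begin

text \<open>
  A reduced word lists the inversions of \<open>p\<close>, as pairs of values, in the order in which they are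
  created. The statistic counts the pairs in \<open>L\<^sub>2\<close> of inversions \<open>(a, b)\<close>, \<open>(c, d)\<close> with \<open>a < c\<close> that
  occur in this order; each move changes it by exactly one. A word admits no increasing move only if
  the smaller values of its inversions appear in weakly increasing order (this uses \<open>312\<close>-avoidance),
  and no decreasing move only if they appear in weakly decreasing order. Each of these conditions
  determines the word, so the statistic has a unique local maximum \<open>t\<close>, of value \<open>|L\<^sub>2|\<close>, and a
  unique local minimum \<open>b\<close>, of value \<open>0\<close>. Hence \<open>t\<close> and \<open>b\<close> are at distance \<open>|L\<^sub>2|\<close>, and two
  arbitrary words are joined through \<open>t\<close> or through \<open>b\<close> within that distance.
\<close>

section \<open>The diameter of a graph graded by a Lipschitz function\<close>

context wf_digraph
begin

lemma mu_le_relpow: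
  assumes "(u, v) \<in> arcs_ends G ^^ k" "u \<in> verts G"
  shows "\<mu> (\<lambda>_. 1) u v \<le> ereal (real k)"
proof -
  have "\<exists>q. awalk u q v \<and> length q = k"
    using assms
  proof (induction k arbitrary: u)
    case 0
    then show ?case by (auto simp: awalk_Nil_iff)
  next
    case (Suc k)
    then obtain w where w: "(u, w) \<in> arcs_ends G" "(w, v) \<in> arcs_ends G ^^ k"
      by (metis relpow_Suc_E2)
    then obtain e where e: "e \<in> arcs G" "tail G e = u" "head G e = w"
      by (auto simp: arcs_ends_def arc_to_ends_def)
    with Suc.IH[OF w(2)] obtain q where "awalk w q v" "length q = k"
      by fastforce
    with e have "awalk u (e # q) v \<and> length (e # q) = Suc k"
      by (simp add: awalk_Cons_iff)
    then show ?case by blast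
  qed
  then obtain q where q: "awalk u q v" "length q = k" by blast
  then have "awalk_cost (\<lambda>_. 1) q = real k"
    by (simp add: awalk_cost_def sum_list_triv)
  with min_cost_le_walk_cost[OF q(1), of "\<lambda>_. 1"] show ?thesis by simp
qed

text \<open>Each arc raises \<open>f\<close> by at most one, so a walk is at least as long as its
  gain in \<open>f\<close>. The difference is taken in the reals because it may be negative.\<close>

lemma lipschitz_le_mu:
  fixes f :: "'a \<Rightarrow> nat"
  assumes "\<And>u v. (u, v) \<in> arcs_ends G \<Longrightarrow> f v \<le> Suc (f u)"
  shows "ereal (real (f v) - real (f u)) \<le> \<mu> (\<lambda>_. 1) u v"
  unfolding \<mu>_def
proof (rule INF_greatest)
  fix q assume "q \<in> {q. awalk u q v}"
  then have "f v \<le> f u + length q"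
  proof (induction q arbitrary: u)
    case Nil
    then show ?case by (simp add: awalk_Nil_iff)
  next
    case (Cons e q)
    then have "f v \<le> f (head G e) + length q" "e \<in> arcs G" "tail G e = u"
      by (simp_all add: awalk_Cons_iff)
    moreover from this have "f (head G e) \<le> Suc (f u)"
      by (intro assms) (auto simp: arcs_ends_def arc_to_ends_def)
    ultimately show ?case by simp
  qed
  then show "ereal (real (f v) - real (f u)) \<le> ereal (awalk_cost (\<lambda>_. 1) q)"
    by (simp add: awalk_cost_def sum_list_triv)
qed

text \<open>Two vertices are joined both through the top and through the bottom of the grading, and
  the lengths of these two walks add up to twice the height.\<close>

lemma diam_graded:
  fixes f :: "'a \<Rightarrow> nat"
  assumes sym: "sym (arcs_ends G)"
    and lip: "\<And>u v. (u, v) \<in> arcs_ends G \<Longrightarrow> f v \<le> Suc (f u)"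
    and bound: "\<And>v. v \<in> verts G \<Longrightarrow> f v \<le> N"
    and top: "t \<in> verts G" "f t = N"
    and bot: "b \<in> verts G" "f b = 0"
    and up: "\<And>v. v \<in> verts G \<Longrightarrow> v \<noteq> t \<Longrightarrow> \<exists>w. (v, w) \<in> arcs_ends G \<and> f w = Suc (f v)"
    and down: "\<And>v. v \<in> verts G \<Longrightarrow> v \<noteq> b \<Longrightarrow> \<exists>w. (v, w) \<in> arcs_ends G \<and> f v = Suc (f w)"
  shows "diam G = ereal (real N)"
proof -
  have in_verts: "w \<in> verts G" if "(v, w) \<in> arcs_ends G" for v w
    using that by (auto simp: arcs_ends_def arc_to_ends_def)
  have to_top: "(v, t) \<in> arcs_ends G ^^ (N - f v)" if "v \<in> verts G" for v
    using that
  proof (induction "N - f v" arbitrary: v)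
    case 0
    \<comment> \<open>Another vertex of value \<open>N\<close> would have a neighbour of value
      \<open>N + 1\<close>, against \<open>bound\<close>.\<close>
    then have "v = t"
      using up[of v] bound in_verts by (metis Suc_n_not_le_n diff_is_0_eq le_antisym)
    then show ?case using 0 by simp
  next
    case (Suc m)
    then have "v \<noteq> t" using top by auto
    then obtain w where w: "(v, w) \<in> arcs_ends G" "f w = Suc (f v)"
      using up Suc.prems by blast
    then have m: "m = N - f w" using Suc.hyps(2) by simp
    have "(w, t) \<in> arcs_ends G ^^ m"
      using Suc.hyps(1)[OF m in_verts[OF w(1)]] m by simp
    then show ?case using w(1) Suc.hyps(2) by (metis relpow_Suc_I2)
  qed
  have to_bot: "(v, b) \<in> arcs_ends G ^^ (f v)" if "v \<in> verts G" for v
    using that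
  proof (induction "f v" arbitrary: v)
    case 0
    then have "v = b" using down[of v] by fastforce
    then show ?case using 0 by simp
  next
    case (Suc m)
    then have "v \<noteq> b" using bot by auto
    then obtain w where w: "(v, w) \<in> arcs_ends G" "f v = Suc (f w)"
      using down Suc.prems by blast
    then have m: "m = f w" using Suc.hyps(2) by simp
    have "(w, b) \<in> arcs_ends G ^^ m"
      using Suc.hyps(1)[OF m in_verts[OF w(1)]] m by simp
    then show ?case using w(1) Suc.hyps(2) by (metis relpow_Suc_I2)
  qed
  have rev_path: "(w, v) \<in> arcs_ends G ^^ k" if "(v, w) \<in> arcs_ends G ^^ k" for v w k
    using that
  proof (induction k arbitrary: v)
    case (Suc k)
    then obtain u where "(v, u) \<in> arcs_ends G" "(u, w) \<in> arcs_ends G ^^ k"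
      by (metis relpow_Suc_E2)
    then show ?case using Suc.IH sym by (meson relpow_Suc_I symD)
  qed simp
  have upper: "\<mu> (\<lambda>_. 1) v w \<le> ereal (real N)" if vw: "v \<in> verts G" "w \<in> verts G" for v w
  proof (cases "f v + f w \<le> N")
    case True
    have "(v, w) \<in> arcs_ends G ^^ (f v + f w)"
      using to_bot[OF vw(1)] rev_path[OF to_bot[OF vw(2)]] by (auto simp: relpow_add)
    from mu_le_relpow[OF this vw(1)] show ?thesis
      using True by (meson ereal_less_eq(3) of_nat_mono order_trans)
  next
    case False
    have "(v, w) \<in> arcs_ends G ^^ ((N - f v) + (N - f w))"
      using to_top[OF vw(1)] rev_path[OF to_top[OF vw(2)]] unfolding relpow_add by blast
    from mu_le_relpow[OF this vw(1)]
    have "\<mu> (\<lambda>_. 1) v w \<le> ereal (real ((N - f v) + (N - f w)))" .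
    moreover have "(N - f v) + (N - f w) \<le> N"
      using False bound vw by fastforce
    ultimately show ?thesis by (meson ereal_less_eq(3) of_nat_mono order_trans)
  qed
  have lower: "ereal (real N) \<le> \<mu> (\<lambda>_. 1) b t"
    using lipschitz_le_mu[of f t b] lip top bot by simp
  show ?thesis
    unfolding diam_def
  proof (rule antisym)
    show "(SUP u\<in>verts G. SUP v\<in>verts G. \<mu> (\<lambda>_. 1) u v) \<le> ereal (real N)"
      using upper by (intro SUP_least)
    show "ereal (real N) \<le> (SUP u\<in>verts G. SUP v\<in>verts G. \<mu> (\<lambda>_. 1) u v)"
      using lower top(1) bot(1) by (meson SUP_upper2)
  qed
qed

end

section \<open>Crossings of a word\<close>

abbreviation adj :: "nat \<Rightarrow> nat \<Rightarrow> nat" where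
  "adj r \<equiv> transpose r (Suc r)"

text \<open>The wires (values) exchanged by the successive letters, as left and right wire, when the
  word is read from left to right starting from the arrangement \<open>v\<close>.\<close>

fun crossings :: "(nat \<Rightarrow> nat) \<Rightarrow> nat list \<Rightarrow> (nat \<times> nat) list" where
  "crossings v [] = []"
| "crossings v (r # w) = (v r, v (Suc r)) # crossings (v \<circ> adj r) w"

text \<open>Each crossing has the smaller value on the left, so it creates an inversion. For words
  read from \<open>id\<close> this characterises reducedness, see
  \<open>reduced_words_iff\<close>.\<close>

definition ascending :: "(nat \<times> nat) list \<Rightarrow> bool" where
  "ascending L \<longleftrightarrow> (\<forall>(a, b) \<in> set L. a < b)"

lemma ascending_simps [simp]:
  "ascending []"
  "ascending ((a, b) # L) \<longleftrightarrow> a < b \<and> ascending L"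
  "ascending (L @ M) \<longleftrightarrow> ascending L \<and> ascending M"
  by (auto simp: ascending_def)

lemma word_perm_simps [simp]:
  "word_perm [] = id"
  "word_perm (r # w) = adj r \<circ> word_perm w"
  by (simp_all add: word_perm_def)

lemma word_perm_append: "word_perm (u @ w) = word_perm u \<circ> word_perm w"
  by (induction u) (simp_all add: comp_assoc)

lemma bij_word_perm [simp]: "bij (word_perm w)"
proof (induction w)
  case Nil
  show "bij (word_perm [])" by simp
next
  case (Cons r w)
  have "bij (word_perm w)" by (fact Cons.IH)
  then show "bij (word_perm (r # w))" by (simp add: bij_comp)
qed

lemma crossings_append:
  "crossings v (u @ w) = crossings v u @ crossings (v \<circ> word_perm u) w"
  by (induction u arbitrary: v) (simp_all add: comp_assoc)

lemma length_crossings [simp]: "length (crossings v w) = length w"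
  by (induction w arbitrary: v) simp_all

text \<open>In an injective arrangement the left wire reveals the position \<open>r\<close>, so the
  first components alone recover the word. This is what makes the sorted words unique.\<close>

lemma crossings_inject:
  assumes "inj v" "map fst (crossings v w) = map fst (crossings v w')"
  shows "w = w'"
  using assms
proof (induction w arbitrary: v w')
  case Nil
  then show ?case by (metis length_crossings length_map list.size(3) length_0_conv)
next
  case (Cons r w)
  then obtain r' w'' where [simp]: "w' = r' # w''"
    by (cases w') auto
  have "r = r'" using Cons.prems by (simp add: inj_eq)
  moreover have "inj (v \<circ> adj r)" using Cons.prems by (simp add: inj_compose)
  ultimately show ?case using Cons.prems Cons.IH by auto
qed

section \<open>Inversions as pairs of values\<close>

definition value_inversions :: "(nat \<Rightarrow> nat) \<Rightarrow> (nat \<times> nat) set" where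
  "value_inversions v = {(v y, v x) | x y. x < y \<and> v y < v x}"

lemma value_inversions_iff:
  assumes "inj v"
  shows "(v x, v y) \<in> value_inversions v \<longleftrightarrow> v x < v y \<and> y < x"
  using assms by (auto simp: value_inversions_def inj_eq)

text \<open>Exchanging two adjacent positions changes the relative order of the two wires there and
  of no others.\<close>

lemma value_inversions_adj:
  assumes "bij v" "v r < v (Suc r)"
  shows "(v r, v (Suc r)) \<notin> value_inversions v"
    and "value_inversions (v \<circ> adj r) = insert (v r, v (Suc r)) (value_inversions v)"
proof -
  note inj = bij_is_inj[OF assms(1)]
  show "(v r, v (Suc r)) \<notin> value_inversions v"
    using inj by (simp add: value_inversions_iff)
  have inj': "inj (v \<circ> adj r)" using inj by (simp add: inj_compose)
  have "(c, d) \<in> value_inversions (v \<circ> adj r) \<longleftrightarrow>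
      (c, d) \<in> insert (v r, v (Suc r)) (value_inversions v)" for c d
  proof -
    obtain x y where cd: "c = v x" "d = v y"
      using assms(1) by (metis bij_pointE)
    have "(c, d) \<in> value_inversions (v \<circ> adj r) \<longleftrightarrow> v x < v y \<and> adj r y < adj r x"
      using value_inversions_iff[OF inj', of "adj r x" "adj r y"] by (simp add: cd)
    moreover have "adj r y < adj r x \<longleftrightarrow> (x = r \<and> y = Suc r) \<or> (y < x \<and> \<not> (y = r \<and> x = Suc r))"
      by (auto simp: transpose_def)
    ultimately show ?thesis
      using assms(2) inj by (auto simp: cd value_inversions_iff inj_eq)
  qed
  then show "value_inversions (v \<circ> adj r) = insert (v r, v (Suc r)) (value_inversions v)"
    by auto
qed

text \<open>Each ascending crossing adds a new inversion and removes none, so no crossing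
  recurs.\<close>

lemma crossings_value_inversions:
  assumes "bij v" "ascending (crossings v w)"
  shows "distinct (crossings v w)"
    and "set (crossings v w) \<inter> value_inversions v = {}"
    and "value_inversions (v \<circ> word_perm w) = value_inversions v \<union> set (crossings v w)"
proof -
  have "distinct (crossings v w) \<and> set (crossings v w) \<inter> value_inversions v = {} \<and>
    value_inversions (v \<circ> word_perm w) = value_inversions v \<union> set (crossings v w)"
    using assms
  proof (induction w arbitrary: v)
    case (Cons r w)
    define u where "u = v \<circ> adj r"
    have "bij u" using Cons.prems(1) by (simp add: u_def bij_comp)
    moreover have "ascending (crossings u w)" "v r < v (Suc r)"
      using Cons.prems(2) by (simp_all add: u_def)
    moreover have IH: "distinct (crossings u w)"
      "set (crossings u w) \<inter> value_inversions u = {}"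
      "value_inversions (u \<circ> word_perm w) = value_inversions u \<union> set (crossings u w)"
      using Cons.IH[OF \<open>bij u\<close> \<open>ascending (crossings u w)\<close>] by blast+
    moreover have "value_inversions u = insert (v r, v (Suc r)) (value_inversions v)"
      "(v r, v (Suc r)) \<notin> value_inversions v"
      using value_inversions_adj[OF Cons.prems(1)] \<open>v r < v (Suc r)\<close> by (simp_all add: u_def)
    moreover have "crossings v (r # w) = (v r, v (Suc r)) # crossings u w"
      "v \<circ> word_perm (r # w) = u \<circ> word_perm w"
      by (simp_all add: u_def comp_assoc del: comp_apply)
    ultimately show "distinct (crossings v (r # w)) \<and>
        set (crossings v (r # w)) \<inter> value_inversions v = {} \<and>
        value_inversions (v \<circ> word_perm (r # w)) =
          value_inversions v \<union> set (crossings v (r # w))"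
      by simp
  qed auto
  then show "distinct (crossings v w)"
    and "set (crossings v w) \<inter> value_inversions v = {}"
    and "value_inversions (v \<circ> word_perm w) = value_inversions v \<union> set (crossings v w)"
    by auto
qed

lemma value_inversions_id [simp]: "value_inversions id = {}"
  by (auto simp: value_inversions_def)

lemma crossings_id:
  assumes "ascending (crossings id w)"
  shows "distinct (crossings id w)"
    and "set (crossings id w) = value_inversions (word_perm w)"
  using crossings_value_inversions[of id w] assms by auto

text \<open>The left side ranges over all positions, but \<open>p\<close> fixes those outside
  \<open>{1..n}\<close> and preserves the interval, so no inversion involves an outside
  position.\<close>

lemma value_inversions_permutes:
  assumes "p permutes {1..n}"
  shows "value_inversions p = (\<lambda>(i, j). (p j, p i)) ` inversions n p"
proof -
  have "i \<in> {1..n} \<and> j \<in> {1..n}" if "i < j" "p j < p i" for i j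
  proof -
    have fix_out: "p k = k" if "k \<notin> {1..n}" for k using assms that by (simp add: permutes_not_in)
    have stays: "p k \<in> {1..n}" if "k \<in> {1..n}" for k using that permutes_in_image[OF assms] by simp
    show ?thesis
      using that fix_out[of i] fix_out[of j] stays[of i] stays[of j]
      by (cases "i \<in> {1..n}"; cases "j \<in> {1..n}") (auto simp: not_le)
  qed
  then show ?thesis
    by (auto simp: value_inversions_def inversions_def image_iff)
qed

lemma finite_inversions: "finite (inversions n p)"
  by (rule finite_subset[of _ "{1..n} \<times> {1..n}"]) (auto simp: inversions_def)

lemma finite_value_inversions:
  assumes "p permutes {1..n}"
  shows "finite (value_inversions p)"
  using value_inversions_permutes[OF assms] finite_inversions by simp

section \<open>Reduced words\<close>

lemma adj_permutes: "r \<in> {1..<n} \<Longrightarrow> adj r permutes {1..n}"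
  by (intro permutes_swap_id) auto

lemma card_value_inversions_adj:
  assumes "p permutes {1..n}" "r \<in> {1..<n}"
  shows "p r < p (Suc r) \<Longrightarrow>
      card (value_inversions (p \<circ> adj r)) = Suc (card (value_inversions p))"
    and "\<not> p r < p (Suc r) \<Longrightarrow>
      card (value_inversions p) = Suc (card (value_inversions (p \<circ> adj r)))"
proof -
  have card: "card (value_inversions (q \<circ> adj r)) = Suc (card (value_inversions q))"
    if "q permutes {1..n}" "q r < q (Suc r)" for q
    using value_inversions_adj[OF permutes_bij[OF that(1)] that(2)] finite_value_inversions[OF that(1)]
    by simp
  show "p r < p (Suc r) \<Longrightarrow>
      card (value_inversions (p \<circ> adj r)) = Suc (card (value_inversions p))"
    using card assms by blast
  assume "\<not> p r < p (Suc r)"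
  moreover have "p r \<noteq> p (Suc r)" using permutes_inj[OF assms(1)] by (simp add: inj_eq)
  \<comment> \<open>A descent of \<open>p\<close> at \<open>r\<close> is an ascent of
    \<open>p \<circ> adj r\<close>, and \<open>adj r\<close> is an involution; so the ascending case
    applies to \<open>p \<circ> adj r\<close>.\<close>
  moreover have "(p \<circ> adj r) permutes {1..n}"
    using assms adj_permutes by (blast intro: permutes_compose)
  ultimately show "card (value_inversions p) = Suc (card (value_inversions (p \<circ> adj r)))"
    using card[of "p \<circ> adj r"] by (simp add: comp_assoc)
qed

text \<open>Every letter changes the number of inversions by exactly one. A single descending
  crossing lowers it, and the remaining letters cannot make up for the loss.\<close>

lemma card_value_inversions_le_length:
  assumes "v permutes {1..n}" "set w \<subseteq> {1..<n}"
  shows "card (value_inversions (v \<circ> word_perm w)) \<le> card (value_inversions v) + length w"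
    and "\<not> ascending (crossings v w) \<Longrightarrow>
      card (value_inversions (v \<circ> word_perm w)) < card (value_inversions v) + length w"
proof -
  have "card (value_inversions (v \<circ> word_perm w)) \<le> card (value_inversions v) + length w \<and>
    (\<not> ascending (crossings v w) \<longrightarrow>
      card (value_inversions (v \<circ> word_perm w)) < card (value_inversions v) + length w)"
    using assms
  proof (induction w arbitrary: v)
    case (Cons r w)
    define u where "u = v \<circ> adj r"
    have "u permutes {1..n}"
      using Cons.prems adj_permutes by (auto simp: u_def intro: permutes_compose)
    then have "card (value_inversions (u \<circ> word_perm w)) \<le> card (value_inversions u) + length w \<and>
      (\<not> ascending (crossings u w) \<longrightarrow>
        card (value_inversions (u \<circ> word_perm w)) < card (value_inversions u) + length w)"
      by (rule Cons.IH) (use Cons.prems(2) in simp)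
    moreover have "crossings v (r # w) = (v r, v (Suc r)) # crossings u w"
      by (simp add: u_def)
    moreover have "v \<circ> word_perm (r # w) = u \<circ> word_perm w"
      by (simp add: u_def comp_assoc)
    moreover have "v r < v (Suc r) \<Longrightarrow> card (value_inversions u) = Suc (card (value_inversions v))"
      "\<not> v r < v (Suc r) \<Longrightarrow> card (value_inversions v) = Suc (card (value_inversions u))"
      using Cons.prems by (auto simp: u_def intro!: card_value_inversions_adj)
    ultimately show "card (value_inversions (v \<circ> word_perm (r # w)))
        \<le> card (value_inversions v) + length (r # w) \<and>
      (\<not> ascending (crossings v (r # w)) \<longrightarrow>
        card (value_inversions (v \<circ> word_perm (r # w))) < card (value_inversions v) + length (r # w))"
      by (cases "v r < v (Suc r)") simp_all
  qed auto
  then show "card (value_inversions (v \<circ> word_perm w)) \<le> card (value_inversions v) + length w"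
    and "\<not> ascending (crossings v w) \<Longrightarrow>
      card (value_inversions (v \<circ> word_perm w)) < card (value_inversions v) + length w"
    by auto
qed

lemma permutes_ascending_imp_id:
  assumes "p permutes {1..n}" "\<And>r. r \<in> {1..<n} \<Longrightarrow> p r < p (Suc r)"
  shows "p = id"
proof -
  have "k \<le> p k" if "1 \<le> k" "k \<le> n" for k
    using that
  proof (induction k rule: dec_induct)
    case base
    then show ?case using permutes_in_image[OF assms(1), of 1] by simp
  next
    case (step k)
    then show ?case using assms(2)[of k] by simp
  qed
  then show ?thesis by (intro permutes_natset_ge[OF assms(1)]) auto
qed

text \<open>A permutation other than \<open>id\<close> has a descent; removing it costs one
  inversion and accounts for the last letter of the word.\<close>

lemma ex_word_of_length_card_value_inversions:
  assumes "p permutes {1..n}"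
  shows "\<exists>w \<in> words_for n p. length w = card (value_inversions p)"
  using assms
proof (induction "card (value_inversions p)" arbitrary: p rule: less_induct)
  case less
  show ?case
  proof (cases "p = id")
    case True
    then show ?thesis by (auto simp: words_for_def)
  next
    case False
    then obtain r where r: "r \<in> {1..<n}" "\<not> p r < p (Suc r)"
      using permutes_ascending_imp_id[OF less.prems] by blast
    note card = card_value_inversions_adj(2)[OF less.prems r]
    have "(p \<circ> adj r) permutes {1..n}"
      using less.prems adj_permutes r by (auto intro: permutes_compose)
    with less.hyps[of "p \<circ> adj r"] card
    obtain w where "w \<in> words_for n (p \<circ> adj r)" "Suc (length w) = card (value_inversions p)"
      by auto
    then have "w @ [r] \<in> words_for n p \<and> length (w @ [r]) = card (value_inversions p)"
      using r by (auto simp: words_for_def word_perm_append comp_assoc)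
    then show ?thesis by blast
  qed
qed

text \<open>The minimal length is the number of inversions: ascending words have exactly this
  length, all others are longer.\<close>

lemma reduced_words_iff:
  assumes "p permutes {1..n}"
  shows "w \<in> reduced_words n p \<longleftrightarrow> w \<in> words_for n p \<and> ascending (crossings id w)"
proof -
  obtain w0 where w0: "w0 \<in> words_for n p" "length w0 = card (value_inversions p)"
    using ex_word_of_length_card_value_inversions[OF assms] by blast
  have le: "card (value_inversions p) \<le> length v" if "v \<in> words_for n p" for v
    using that card_value_inversions_le_length(1)[of id n v] by (auto simp: words_for_def permutes_id)
  have less: "card (value_inversions p) < length v"
    if "v \<in> words_for n p" "\<not> ascending (crossings id v)" for v
    using that card_value_inversions_le_length(2)[of id n v] by (auto simp: words_for_def permutes_id)
  have eq: "card (value_inversions p) = length v"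
    if "v \<in> words_for n p" "ascending (crossings id v)" for v
    using crossings_id[OF that(2)] that(1) distinct_card[of "crossings id v"]
    by (simp add: words_for_def)
  show ?thesis
  proof
    assume "w \<in> reduced_words n p"
    then show "w \<in> words_for n p \<and> ascending (crossings id w)"
      using less w0 by (force simp: reduced_words_def)
  next
    assume "w \<in> words_for n p \<and> ascending (crossings id w)"
    then show "w \<in> reduced_words n p"
      using le eq by (auto simp: reduced_words_def)
  qed
qed

lemma reduced_words_nonempty:
  assumes "p permutes {1..n}"
  shows "reduced_words n p \<noteq> {}"
proof -
  obtain w0 where w0: "w0 \<in> words_for n p" "length w0 = card (value_inversions p)"
    using ex_word_of_length_card_value_inversions[OF assms] by blast
  then have "w0 \<in> reduced_words n p"
    using card_value_inversions_le_length(1)[OF permutes_id]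
    by (force simp: reduced_words_def words_for_def)
  then show ?thesis by blast
qed

section \<open>Counting independent pairs of crossings\<close>

text \<open>Two inversions \<open>(a, b)\<close> and \<open>(c, d)\<close> (pairs of values) with \<open>a < c\<close> and \<open>b \<noteq> d\<close> are either
  disjoint or have \<open>b = c\<close>; the latter are the outer pairs of the occurrences of \<open>321\<close>. So these
  pairs encode \<open>L\<^sub>2\<close>.\<close>

definition indep :: "nat \<times> nat \<Rightarrow> nat \<times> nat \<Rightarrow> bool" where
  "indep x y \<longleftrightarrow> fst x < fst y \<and> snd x \<noteq> snd y"

fun agree :: "(nat \<times> nat) list \<Rightarrow> nat" where
  "agree [] = 0"
| "agree (x # L) = length (filter (indep x) L) + agree L"

definition indep_pairs :: "(nat \<times> nat) set \<Rightarrow> ((nat \<times> nat) \<times> (nat \<times> nat)) set" where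
  "indep_pairs S = {(x, y). x \<in> S \<and> y \<in> S \<and> indep x y}"

lemma length_filter_mset_cong:
  assumes "mset L = mset M"
  shows "length (filter P L) = length (filter P M)"
  using assms by (metis mset_filter size_mset)

lemma agree_append:
  "agree (L @ M) = agree L + agree M + (\<Sum>x\<leftarrow>L. length (filter (indep x) M))"
  by (induction L) simp_all

text \<open>Rearranging a block affects only the pairs lying inside it. The additive form avoids
  subtraction of naturals.\<close>

lemma agree_cong:
  assumes "mset B = mset B'"
  shows "agree (X @ B @ Y) + agree B' = agree (X @ B' @ Y) + agree B"
proof -
  have "(\<Sum>x\<leftarrow>B. length (filter (indep x) Y)) = (\<Sum>x\<leftarrow>B'. length (filter (indep x) Y))"
    using assms by (metis mset_map sum_mset_sum_list)
  then show ?thesis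
    using length_filter_mset_cong[OF assms] by (simp add: agree_append)
qed

lemma agree_bounds:
  assumes "distinct L"
  shows "agree L \<le> card (indep_pairs (set L))"
    and "sorted (map fst L) \<Longrightarrow> agree L = card (indep_pairs (set L))"
proof -
  have fin: "finite (indep_pairs (set M))" for M
    by (rule finite_subset[of _ "set M \<times> set M"]) (auto simp: indep_pairs_def)
  have count: "card (indep_pairs (set M) \<union> Pair x ` set (filter (indep x) M)) =
      card (indep_pairs (set M)) + length (filter (indep x) M)" if "distinct (x # M)" for x M
    using that fin by (subst card_Un_disjoint)
      (auto simp: indep_pairs_def card_image inj_on_def distinct_card[symmetric] simp del: set_filter)
  have "agree L \<le> card (indep_pairs (set L)) \<and>
      (sorted (map fst L) \<longrightarrow> agree L = card (indep_pairs (set L)))"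
    using assms
  proof (induction L)
    case Nil
    then show ?case by (simp add: indep_pairs_def)
  next
    case (Cons x L)
    let ?U = "indep_pairs (set L) \<union> Pair x ` set (filter (indep x) L)"
    have "?U \<subseteq> indep_pairs (set (x # L))" by (auto simp: indep_pairs_def)
    then have "card ?U \<le> card (indep_pairs (set (x # L)))" by (rule card_mono[OF fin])
    \<comment> \<open>Sortedness makes \<open>fst x\<close> minimal, so no independent pair has
      \<open>x\<close> as its second member.\<close>
    moreover have "indep_pairs (set (x # L)) = ?U" if "sorted (map fst (x # L))"
      using that by (auto simp: indep_pairs_def indep_def)
    ultimately show ?case using Cons count[OF Cons.prems] by auto
  qed
  then show "agree L \<le> card (indep_pairs (set L))"
    and "sorted (map fst L) \<Longrightarrow> agree L = card (indep_pairs (set L))"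
    by auto
qed

lemma agree_eq_0: "sorted (rev (map fst L)) \<Longrightarrow> agree L = 0"
  by (induction L) (fastforce simp: sorted_append indep_def filter_empty_conv)+

section \<open>Moves\<close>

definition move :: "nat list \<Rightarrow> nat list \<Rightarrow> bool" where
  "move u w \<longleftrightarrow> commutation_move u w \<or> braid_move u w"

lemma move_sym: "move u w \<Longrightarrow> move w u"
  using commutation_move_sym braid_move_sym by (auto simp: move_def)

lemma move_context:
  assumes "move u w"
  shows "move (x @ u @ y) (x @ w @ y)"
  using assms unfolding move_def
proof (elim disjE)
  assume "commutation_move u w"
  then obtain x' y' j k where "\<bar>int j - int k\<bar> > 1" "u = x' @ [j, k] @ y'" "w = x' @ [k, j] @ y'"
    unfolding commutation_move_def by blast
  then have "commutation_move (x @ u @ y) (x @ w @ y)"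
    unfolding commutation_move_def by (metis append.assoc)
  then show "commutation_move (x @ u @ y) (x @ w @ y) \<or> braid_move (x @ u @ y) (x @ w @ y)" ..
next
  assume "braid_move u w"
  then obtain x' y' j where
    "u = x' @ [j, j + 1, j] @ y' \<and> w = x' @ [j + 1, j, j + 1] @ y' \<or>
     u = x' @ [j + 1, j, j + 1] @ y' \<and> w = x' @ [j, j + 1, j] @ y'"
    unfolding braid_move_def by blast
  then have "braid_move (x @ u @ y) (x @ w @ y)"
    unfolding braid_move_def
    by (intro exI[of _ "x @ x'"] exI[of _ "y' @ y"] exI[of _ j]) auto
  then show "commutation_move (x @ u @ y) (x @ w @ y) \<or> braid_move (x @ u @ y) (x @ w @ y)" ..
qed

lemma move_commute: "Suc j < k \<or> Suc k < j \<Longrightarrow> move [j, k] [k, j]"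
  unfolding move_def commutation_move_def
  by (rule disjI1, rule exI[of _ "[]"], rule exI[of _ "[]"]) auto

text \<open>Oriented so that \<open>agree\<close> rises when the wires involved ascend.\<close>

lemma move_braid: "move [Suc j, j, Suc j] [j, Suc j, j]"
  unfolding move_def braid_move_def
  by (rule disjI2, rule exI[of _ "[]"], rule exI[of _ "[]"]) auto

lemma moveE:
  assumes "move u w"
  obtains (commute) x y j k where "Suc j < k \<or> Suc k < j" "u = x @ [j, k] @ y" "w = x @ [k, j] @ y"
  | (braid) x y j where "u = x @ [Suc j, j, Suc j] @ y" "w = x @ [j, Suc j, j] @ y"
  | (braid') x y j where "u = x @ [j, Suc j, j] @ y" "w = x @ [Suc j, j, Suc j] @ y"
  using assms unfolding move_def
proof
  assume "commutation_move u w"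
  then obtain x y j k where *: "\<bar>int j - int k\<bar> > 1" "u = x @ [j, k] @ y" "w = x @ [k, j] @ y"
    unfolding commutation_move_def by blast
  then have "Suc j < k \<or> Suc k < j" by linarith
  with * show ?thesis using commute by blast
next
  assume "braid_move u w"
  then show ?thesis using braid braid' unfolding braid_move_def by force
qed

lemma word_perm_commute: "Suc j < k \<or> Suc k < j \<Longrightarrow> word_perm [j, k] = word_perm [k, j]"
  by (auto simp: fun_eq_iff transpose_def)

lemma word_perm_braid: "word_perm [Suc j, j, Suc j] = word_perm [j, Suc j, j]"
  by (auto simp: fun_eq_iff transpose_def)

lemma crossings_commute:
  assumes "Suc j < k \<or> Suc k < j"
  shows "crossings v [j, k] = [(v j, v (Suc j)), (v k, v (Suc k))]"
  using assms by auto

text \<open>Both sides list the same three pairs in opposite orders. The middle pair shares a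
  coordinate with each outer one, so only the two outer pairs can be independent.\<close>

lemma crossings_braid:
  "crossings v [Suc j, j, Suc j] =
    [(v (Suc j), v (Suc (Suc j))), (v j, v (Suc (Suc j))), (v j, v (Suc j))]"
  "crossings v [j, Suc j, j] =
    [(v j, v (Suc j)), (v j, v (Suc (Suc j))), (v (Suc j), v (Suc (Suc j)))]"
  by simp_all

lemma move_word_perm: "move u w \<Longrightarrow> word_perm u = word_perm w"
proof (erule moveE)
  fix x y j k
  assume "Suc j < k \<or> Suc k < j" "u = x @ [j, k] @ y" "w = x @ [k, j] @ y"
  then show "word_perm u = word_perm w"
    using word_perm_commute[of j k] by (simp only: word_perm_append)
qed (simp_all only: word_perm_append word_perm_braid)

lemma move_set: "move u w \<Longrightarrow> set u = set w"
  by (erule moveE) auto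

lemma mset_crossings_context:
  assumes "mset (crossings (v \<circ> word_perm x) u) = mset (crossings (v \<circ> word_perm x) w)"
    and "word_perm u = word_perm w"
  shows "mset (crossings v (x @ u @ y)) = mset (crossings v (x @ w @ y))"
  using assms by (simp add: crossings_append)

lemma move_mset_crossings:
  assumes "move u w"
  shows "mset (crossings v u) = mset (crossings v w)"
  using assms
proof (cases rule: moveE)
  case (commute x y j k)
  then show ?thesis
    unfolding commute(2,3)
    by (intro mset_crossings_context word_perm_commute) auto
next
  case (braid x y j)
  then show ?thesis
    unfolding braid
    by (intro mset_crossings_context word_perm_braid) (auto simp: crossings_braid simp del: crossings.simps)
next
  case (braid' x y j)
  then show ?thesis
    unfolding braid'
    by (intro mset_crossings_context word_perm_braid[symmetric])
      (auto simp: crossings_braid simp del: crossings.simps)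
qed

text \<open>Moves preserve the product and the set of crossings, and \<open>ascending\<close>
  depends on that set alone.\<close>

lemma move_reduced_words:
  assumes "p permutes {1..n}" "u \<in> reduced_words n p" "move u w"
  shows "w \<in> reduced_words n p"
  using assms move_word_perm[OF assms(3)] move_set[OF assms(3)]
    mset_eq_setD[OF move_mset_crossings[OF assms(3), of id]]
  by (simp add: reduced_words_iff words_for_def ascending_def)

lemma agree_move_context:
  assumes "move B B'"
  shows "agree (crossings v (x @ B @ y)) + agree (crossings (v \<circ> word_perm x) B') =
    agree (crossings v (x @ B' @ y)) + agree (crossings (v \<circ> word_perm x) B)"
  using agree_cong[OF move_mset_crossings[OF assms, of "v \<circ> word_perm x"], of "crossings v x"
      "crossings (v \<circ> word_perm x \<circ> word_perm B) y"] move_word_perm[OF assms]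
  by (simp add: crossings_append)

text \<open>Only the moved block matters, and it contains at most one independent pair in listed
  order.\<close>

lemma move_agree:
  assumes "move u w"
  shows "agree (crossings v w) \<le> Suc (agree (crossings v u))"
proof -
  have *: "agree (crossings v (x @ B' @ y)) \<le> Suc (agree (crossings v (x @ B @ y)))"
    if "move B B'" "agree (crossings (v \<circ> word_perm x) B') \<le> 1" for x y B B'
    using agree_move_context[OF that(1), of v x y] that(2) by linarith
  show ?thesis
    using assms
  proof (cases rule: moveE)
    case (commute x y j k)
    then show ?thesis
      unfolding commute(2,3)
      by (intro * move_commute) (auto simp: crossings_commute simp del: crossings.simps)
  next
    case (braid x y j)
    show ?thesis
      unfolding braid
      by (intro * move_braid) (simp add: crossings_braid indep_def del: crossings.simps)
  next
    case (braid' x y j)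
    show ?thesis
      unfolding braid'
      by (intro * move_sym[OF move_braid]) (simp add: crossings_braid indep_def del: crossings.simps)
  qed
qed

text \<open>Take the last crossing \<open>(a, b)\<close> followed by some \<open>(c, d)\<close> with \<open>c < a\<close>. If they do not commute,
  then \<open>d = b\<close> and the arrangement reads \<open>b c a\<close> afterwards; avoidance of \<open>312\<close> forces \<open>(c, a)\<close> to
  occur later, and sortedness of the rest forces it to occur immediately.\<close>

lemma ex_move_up:
  assumes "bij v" "ascending (crossings v w)" "value_inversions (v \<circ> word_perm w) = V"
    and avoid: "\<And>a b c. c < a \<Longrightarrow> a < b \<Longrightarrow> (c, b) \<in> V \<Longrightarrow> (a, b) \<in> V \<Longrightarrow> (c, a) \<in> V"
    and "\<not> sorted (map fst (crossings v w))"
  shows "\<exists>w'. move w w' \<and> agree (crossings v w') = Suc (agree (crossings v w))"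
  using assms(1-3,5)
proof (induction w arbitrary: v)
  case Nil
  then show ?case by simp
next
  case (Cons j w)
  define u where "u = v \<circ> adj j"
  have "bij u" using Cons.prems(1) by (simp add: u_def bij_comp)
  have asc: "v j < v (Suc j)" "ascending (crossings u w)"
    using Cons.prems(2) by (simp_all add: u_def)
  have V: "value_inversions (u \<circ> word_perm w) = V"
  proof -
    have "v \<circ> word_perm (j # w) = u \<circ> word_perm w" by (simp add: u_def comp_assoc)
    then show ?thesis using Cons.prems(3) by metis
  qed
  show ?case
  proof (cases "sorted (map fst (crossings u w))")
    case False
    then obtain w' where w': "move w w'" "agree (crossings u w') = Suc (agree (crossings u w))"
      using Cons.IH[OF \<open>bij u\<close> asc(2) V] by blast
    have "move (j # w) (j # w')"
      using move_context[OF w'(1), of "[j]" "[]"] by simp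
    \<comment> \<open>The first crossing meets the same multiset of later crossings before and after
      the move.\<close>
    moreover have "agree (crossings v (j # w')) = Suc (agree (crossings v (j # w)))"
      using w'(2) length_filter_mset_cong[OF move_mset_crossings[OF w'(1), of u]]
      by (simp add: u_def)
    ultimately show ?thesis by blast
  next
    case True
    then obtain k w2 where w: "w = k # w2"
      using Cons.prems(4) by (cases w) (auto simp: u_def)
    define t where "t = u \<circ> adj k"
    have desc: "u k < v j"
      \<comment> \<open>The tail is sorted, so sortedness can fail only between the first two
        crossings.\<close>
      using Cons.prems(4) True by (auto simp: w u_def[symmetric] simp flip: t_def)
    have asc2: "u k < u (Suc k)" "ascending (crossings t w2)"
      using asc(2) by (simp_all add: w t_def)
    have "bij t" using \<open>bij u\<close> by (simp add: t_def bij_comp)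
    consider "k = j" | "k = Suc j" | "j = Suc k" | "Suc j < k \<or> Suc k < j"
      by linarith
    then show ?thesis
    proof cases
      case 1
      then show ?thesis using desc asc by (simp add: u_def)
    next
      case 2
      then show ?thesis using desc by (simp add: u_def)
    next
      case 3
      \<comment> \<open>Positions \<open>k\<close>, \<open>Suc k\<close>, \<open>Suc (Suc k)\<close>
        carry \<open>c a b\<close> in \<open>v\<close>, then \<open>c b a\<close> in
        \<open>u\<close> and \<open>b c a\<close> in \<open>t\<close>.\<close>
      define a b c where "a = v j" and "b = v (Suc j)" and "c = v k"
      have abc: "c < a" "a < b"
        using desc asc(1) 3 by (simp_all add: a_def b_def c_def u_def)
      have u_vals: "u k = c" "u (Suc k) = b" "u (Suc (Suc k)) = a"
        using 3 by (simp_all add: u_def a_def b_def c_def)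
      have t_vals: "t k = b" "t (Suc k) = c" "t (Suc (Suc k)) = a"
        using u_vals by (simp_all add: t_def)
      have t_inv: "value_inversions t = insert (c, b) (insert (a, b) (value_inversions v))"
        using value_inversions_adj(2)[OF \<open>bij u\<close> asc2(1)]
          value_inversions_adj(2)[OF \<open>bij v\<close> asc(1)] u_vals
        by (simp add: t_def[symmetric] u_def[symmetric] a_def[symmetric] b_def[symmetric])
      have V_t: "V = value_inversions t \<union> set (crossings t w2)"
        using crossings_value_inversions(3)[OF \<open>bij t\<close> asc2(2)] V
        by (simp add: w t_def comp_assoc)
      have "(c, a) \<in> V" using avoid[OF abc] V_t t_inv by simp
      moreover have "(c, a) \<notin> value_inversions t"
        using value_inversions_iff[OF bij_is_inj[OF \<open>bij t\<close>], of "Suc k" "Suc (Suc k)"] t_vals by simp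
      ultimately have mem: "(c, a) \<in> set (crossings t w2)"
        using V_t by simp
      then obtain h w3 where w2: "w2 = h # w3" by (cases w2) auto
      have srt: "sorted (c # map fst (crossings t w2))"
        using True u_vals by (simp add: w t_def)
      \<comment> \<open>The first components of the rest are sorted and at least \<open>c\<close>,
        and \<open>(c, a)\<close> attains \<open>c\<close>; so the very next crossing has left wire
        \<open>c\<close>.\<close>
      have "t h = c"
      proof (rule antisym)
        show "c \<le> t h" using srt by (simp add: w2)
        show "t h \<le> c" using srt mem by (auto simp: w2)
      qed
      then have "h = Suc k"
        using t_vals \<open>bij t\<close> by (metis bij_pointE)
      then have word: "j # w = [] @ [Suc k, k, Suc k] @ w3"
        by (simp add: w w2 3)
      have "move (j # w) ([] @ [k, Suc k, k] @ w3)"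
        unfolding word by (intro move_context move_braid)
      moreover have "agree (crossings v ([] @ [k, Suc k, k] @ w3)) = Suc (agree (crossings v (j # w)))"
        unfolding word using agree_move_context[OF move_braid[of k], of v "[]" w3] abc 3
        by (simp add: crossings_braid indep_def a_def b_def c_def del: crossings.simps)
      ultimately show ?thesis by blast
    next
      case 4
      have word: "j # w = [] @ [j, k] @ w2"
        by (simp add: w)
      have "move (j # w) ([] @ [k, j] @ w2)"
        unfolding word using 4 by (intro move_context move_commute)
      moreover have "v (Suc k) \<noteq> v (Suc j)"
        using bij_is_inj[OF \<open>bij v\<close>] 4 by (auto simp: inj_eq)
      moreover have "v k < v j" using desc 4 by (auto simp: u_def)
      ultimately have "agree (crossings v ([] @ [k, j] @ w2)) = Suc (agree (crossings v (j # w)))"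
        unfolding word using agree_move_context[OF move_commute[OF 4], of v "[]" w2] 4
        by (auto simp: crossings_commute indep_def simp del: crossings.simps)
      with \<open>move (j # w) ([] @ [k, j] @ w2)\<close> show ?thesis by blast
    qed
  qed
qed

text \<open>Dually, take the first \<open>(a, b)\<close> followed by some \<open>(c, d)\<close> with \<open>a < c\<close>. Here the third crossing
  \<open>(a, c)\<close> of a braid has already occurred because words start at the identity, so \<open>312\<close> plays no
  role.\<close>

lemma ex_move_down:
  assumes "ascending (crossings id w)" "\<not> sorted (rev (map fst (crossings id w)))"
  shows "\<exists>w'. move w w' \<and> agree (crossings id w) = Suc (agree (crossings id w'))"
  using assms
proof (induction w rule: rev_induct)
  case Nil
  then show ?case by simp
next
  case (snoc j w)
  define v where "v = word_perm w"
  have bij_v: "bij v" by (simp add: v_def)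
  have cr: "crossings id (w @ [j]) = crossings id w @ [(v j, v (Suc j))]"
    by (simp add: v_def crossings_append)
  have "ascending (crossings id (w @ [j]))" by (fact snoc.prems(1))
  then have asc: "v j < v (Suc j)" "ascending (crossings id w)"
    unfolding cr by simp_all
  show ?case
  proof (cases "sorted (rev (map fst (crossings id w)))")
    case False
    then obtain w' where w': "move w w'" "agree (crossings id w) = Suc (agree (crossings id w'))"
      using snoc.IH[OF asc(2)] by blast
    have "move (w @ [j]) (w' @ [j])"
      using move_context[OF w'(1), of "[]" "[j]"] by simp
    moreover have "agree (crossings id (w @ [j])) = Suc (agree (crossings id (w' @ [j])))"
      using w'(2) agree_cong[OF move_mset_crossings[OF w'(1), of id], of "[]" "[(v j, v (Suc j))]"]
        move_word_perm[OF w'(1)]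
      by (simp add: crossings_append v_def)
    ultimately show ?thesis by blast
  next
    case True
    then obtain i u' where w: "w = u' @ [i]"
      using snoc.prems(2) by (cases w rule: rev_cases) (auto simp: cr)
    define u where "u = word_perm u'"
    have bij_u: "bij u" by (simp add: u_def)
    have v_u: "v = u \<circ> adj i" by (simp add: v_def w u_def word_perm_append)
    have cr_w: "crossings id w = crossings id u' @ [(u i, u (Suc i))]"
      by (simp add: w u_def crossings_append)
    have incr: "u i < v j"
    proof (rule ccontr)
      assume "\<not> u i < v j"
      then have "sorted (rev (map fst (crossings id (w @ [j]))))"
        using True by (auto simp: cr cr_w)
      then show False using snoc.prems(2) by blast
    qed
    have asc2: "u i < u (Suc i)"
      using asc(2) by (simp add: cr_w)
    consider "j = i" | "j = Suc i" | "i = Suc j" | "Suc i < j \<or> Suc j < i"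
      by linarith
    then show ?thesis
    proof cases
      case 1
      then show ?thesis using asc(1) asc2 by (simp add: v_u)
    next
      case 2
      then show ?thesis using incr by (simp add: v_u)
    next
      case 3
      define a b c where "a = u i" and "b = u (Suc i)" and "c = u j"
      have abc: "a < c" "c < b"
        using incr asc(1) 3 by (simp_all add: a_def b_def c_def v_u)
      have v_vals: "v j = c" "v (Suc j) = b" "v (Suc (Suc j)) = a"
        using 3 by (simp_all add: v_u a_def b_def c_def)
      have "(a, c) \<in> value_inversions v"
        using value_inversions_iff[OF bij_is_inj[OF bij_v], of "Suc (Suc j)" j] v_vals abc by simp
      then have "(a, c) \<in> set (crossings id w)"
        using crossings_id(2)[OF asc(2)] by (simp add: v_def)
      \<comment> \<open>The last crossing of \<open>w\<close> is \<open>(a, b)\<close>, which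
        differs from \<open>(a, c)\<close> because \<open>c < b\<close>.\<close>
      then have mem: "(a, c) \<in> set (crossings id u')"
        using abc by (simp add: cr_w b_def)
      then obtain h u'' where u': "u' = u'' @ [h]" by (cases u' rule: rev_cases) auto
      define t where "t = word_perm u''"
      have u_t: "u = t \<circ> adj h" by (simp add: u_def u' t_def word_perm_append)
      have cr_u': "crossings id u' = crossings id u'' @ [(t h, t (Suc h))]"
        by (simp add: u' t_def crossings_append)
      have srt: "sorted (a # rev (map fst (crossings id u')))"
        using True by (simp add: cr_w a_def)
      \<comment> \<open>The last crossing of \<open>u'\<close> has the least first component there.
        It is at least \<open>a\<close>, and \<open>(a, c)\<close> attains \<open>a\<close>.\<close>
      have "t h = a"
      proof (rule antisym)
        show "a \<le> t h" using srt by (simp add: cr_u')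
        show "t h \<le> a" using srt mem by (auto simp: cr_u')
      qed
      then have "u (Suc h) = u i" by (simp add: u_t a_def)
      then have "h = j"
        using bij_is_inj[OF bij_u] 3 by (simp add: inj_eq)
      then have word: "w @ [j] = u'' @ [j, Suc j, j] @ []"
        by (simp add: w u' 3)
      have mv: "move [j, Suc j, j] [Suc j, j, Suc j]"
        by (rule move_sym[OF move_braid])
      have t_vals: "t j = a" "t (Suc j) = c" "t (Suc (Suc j)) = b"
        using \<open>t h = a\<close> \<open>h = j\<close> 3 by (simp_all add: u_t b_def c_def)
      have "move (w @ [j]) (u'' @ [Suc j, j, Suc j] @ [])"
        unfolding word by (intro move_context mv)
      moreover have "agree (crossings id (w @ [j])) =
          Suc (agree (crossings id (u'' @ [Suc j, j, Suc j] @ [])))"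
        unfolding word using agree_move_context[OF mv, of id u'' "[]"] abc t_vals
        by (simp add: crossings_braid indep_def t_def del: crossings.simps append_Nil2)
      ultimately show ?thesis by blast
    next
      case 4
      have word: "w @ [j] = u' @ [i, j] @ []"
        by (simp add: w)
      have "move (w @ [j]) (u' @ [j, i] @ [])"
        unfolding word using 4 by (intro move_context move_commute)
      moreover have "u (Suc i) \<noteq> u (Suc j)"
        using bij_is_inj[OF bij_u] 4 by (auto simp: inj_eq)
      moreover have "u i < u j" using incr 4 by (auto simp: v_u)
      ultimately have "agree (crossings id (w @ [j])) = Suc (agree (crossings id (u' @ [j, i] @ [])))"
        unfolding word using agree_move_context[OF move_commute[OF 4], of id u' "[]"] 4
        by (auto simp: crossings_commute indep_def u_def simp del: crossings.simps append_Nil2)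
      with \<open>move (w @ [j]) (u' @ [j, i] @ [])\<close> show ?thesis by blast
    qed
  qed
qed

section \<open>The diameter\<close>

text \<open>In terms of positions, an independent pair either is disjoint, with
  \<open>p j < p l\<close> selecting one of its two orders, or is formed by the two outer inversions
  of a \<open>321\<close>.\<close>

lemma card_indep_pairs:
  assumes "p permutes {1..n}"
  shows "card (indep_pairs (value_inversions p)) = card_L2 n p"
proof -
  note inj = permutes_inj[OF assms]
  have p_eq [simp]: "p i = p j \<longleftrightarrow> i = j" for i j using inj by (simp add: inj_eq)
  let ?I = "inversions n p"
  let ?f = "\<lambda>(i, j). (p j, p i)"
  define D where "D = {((i, j), (k, l)). (i, j) \<in> ?I \<and> (k, l) \<in> ?I \<and> p j < p l \<and> i \<noteq> k}"
  define D2 where "D2 = {((i, j), (k, l)). (i, j) \<in> ?I \<and> (k, l) \<in> ?I \<and> p j < p l \<and>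
    {i, j} \<inter> {k, l} = {}}"
  define D3 where "D3 = {((i, j), (k, l)). (i, j) \<in> ?I \<and> (k, l) \<in> ?I \<and> i = l}"
  have inj_f: "inj ?f" by (auto simp: inj_on_def)
  have "indep_pairs (value_inversions p) = map_prod ?f ?f ` D"
    unfolding value_inversions_permutes[OF assms] indep_pairs_def D_def indep_def
    by (auto simp: image_iff) (force simp: case_prod_beta)+
  moreover have "inj_on (map_prod ?f ?f) D"
    using inj_f by (metis inj_on_subset prod.inj_map subset_UNIV)
  ultimately have "card (indep_pairs (value_inversions p)) = card D"
    by (simp add: card_image)
  \<comment> \<open>In \<open>D\<close>, both \<open>i = k\<close> and \<open>j = l\<close> are
    excluded, and \<open>j = k\<close> would give \<open>p l < p j\<close>. The only possible
    overlap is \<open>i = l\<close>.\<close>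
  also have "D = D2 \<union> D3"
    by (auto simp: D_def D2_def D3_def inversions_def)
  also have "card (D2 \<union> D3) = card D2 + card D3"
  proof (rule card_Un_disjoint)
    have "finite (?I \<times> ?I)" by (simp add: finite_inversions)
    then show "finite D2" "finite D3"
      by (rule finite_subset[rotated], auto simp: D2_def D3_def)+
    show "D2 \<inter> D3 = {}" by (auto simp: D2_def D3_def)
  qed
  also have "card D2 = card (I2 n p)"
  proof (rule bij_betw_same_card[of "\<lambda>(x, y). {x, y}"], rule bij_betw_imageI)
    show "inj_on (\<lambda>(x, y). {x, y}) D2"
      by (auto simp: inj_on_def D2_def doubleton_eq_iff)
    have "{(i, j), (k, l)} \<in> (\<lambda>(x, y). {x, y}) ` D2"
      if "(i, j) \<in> ?I" "(k, l) \<in> ?I" "{i, j} \<inter> {k, l} = {}" for i j k l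
    proof (cases "p j < p l")
      case True
      then have "((i, j), (k, l)) \<in> D2" using that by (simp add: D2_def)
      then show ?thesis by force
    next
      case False
      moreover have "p j \<noteq> p l" using that by auto
      ultimately have "p l < p j" by linarith
      then have "((k, l), (i, j)) \<in> D2" using that by (auto simp: D2_def)
      then show ?thesis by (force simp: insert_commute)
    qed
    then show "(\<lambda>(x, y). {x, y}) ` D2 = I2 n p"
      by (auto simp: I2_def D2_def)
  qed
  also have "card D3 = card (I3 n p)"
  \<comment> \<open>With \<open>l = i\<close> the positions satisfy \<open>k < i < j\<close>; the
    missing inversion \<open>(k, j)\<close> follows by transitivity.\<close>
  proof (rule bij_betw_same_card[of "\<lambda>((i, j), (k, l)). ((k, i), (k, j), (i, j))"], rule bij_betw_imageI)
    show "inj_on (\<lambda>((i, j), (k, l)). ((k, i), (k, j), (i, j))) D3"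
      by (auto simp: inj_on_def D3_def)
    have "((i, j), (i, k), (j, k)) \<in> (\<lambda>((i, j), (k, l)). ((k, i), (k, j), (i, j))) ` D3"
      if "(i, j) \<in> ?I" "(j, k) \<in> ?I" for i j k
      using that by (intro image_eqI[of _ _ "((j, k), (i, j))"]) (auto simp: D3_def)
    then show "(\<lambda>((i, j), (k, l)). ((k, i), (k, j), (i, j))) ` D3 = I3 n p"
      by (auto simp: I3_def D3_def inversions_def)
  qed
  finally show ?thesis by (simp add: card_L2_def)
qed

text \<open>The value \<open>b\<close> precedes both \<open>c\<close> and \<open>a\<close>. If
  \<open>c\<close> also preceded \<open>a\<close>, then \<open>b c a\<close> would be an occurrence
  of \<open>312\<close>.\<close>

lemma avoids_312_value_inversions:
  assumes "p permutes {1..n}" "avoids_pattern n p [3, 1, 2]"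
    and "c < a" "a < b" "(c, b) \<in> value_inversions p" "(a, b) \<in> value_inversions p"
  shows "(c, a) \<in> value_inversions p"
proof -
  obtain x y where xy: "(x, y) \<in> inversions n p" "c = p y" "b = p x"
    using assms(5) by (auto simp: value_inversions_permutes[OF assms(1)])
  obtain x' z where z: "(x', z) \<in> inversions n p" "a = p z" "b = p x'"
    using assms(6) by (auto simp: value_inversions_permutes[OF assms(1)])
  have "x' = x" using xy z permutes_inj[OF assms(1)] by (simp add: inj_eq)
  have "\<not> y < z"
  proof
    assume "y < z"
    then have "contains_pattern n p [3, 1, 2]"
      unfolding contains_pattern_def
      using xy z assms(3,4)
      by (intro exI[of _ "[x, y, z]"]) (auto simp: inversions_def less_Suc_eq numeral_3_eq_3)
    then show False using assms(2) by (simp add: avoids_pattern_def)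
  qed
  moreover have "z \<noteq> y" using assms(3) xy z by auto
  ultimately show ?thesis
    using assms(3) xy z by (auto simp: value_inversions_iff[OF permutes_inj[OF assms(1)]])
qed

theorem theorem6p6:
  fixes n :: nat and p :: "nat \<Rightarrow> nat"
  assumes "p permutes {1..n}"
    and "avoids_pattern n p [3, 1, 2]"
  shows "diam (with_proj (reduced_word_graph n p)) = ereal (real (card_L2 n p))"
proof -
  let ?R = "reduced_words n p" and ?G = "with_proj (reduced_word_graph n p)"
  define V where "V = value_inversions p"
  define N where "N = card (indep_pairs V)"
  define f where "f w = agree (crossings id w)" for w
  interpret pair_bidirected_digraph "reduced_word_graph n p"
    by (rule pair_bidirected_reduced_word_graph)
  have verts: "verts ?G = ?R" by (simp add: reduced_word_graph_def)
  have arcs: "(u, w) \<in> arcs_ends ?G \<longleftrightarrow> u \<in> ?R \<and> w \<in> ?R \<and> move u w" for u w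
    by (auto simp: reduced_word_graph_def move_def arcs_ends_def arc_to_ends_def)
  have R: "ascending (crossings id w)" "word_perm w = p" if "w \<in> ?R" for w
    using that reduced_words_iff[OF assms(1)] by (auto simp: words_for_def)
  have cr: "distinct (crossings id w)" "set (crossings id w) = V" if "w \<in> ?R" for w
    using crossings_id[OF R(1)[OF that]] R(2)[OF that] by (simp_all add: V_def)
  \<comment> \<open>All reduced words list the same set of crossings without repetition.\<close>
  have mset_eq: "mset (crossings id u) = mset (crossings id w)" if "u \<in> ?R" "w \<in> ?R" for u w
    using cr[OF that(1)] cr[OF that(2)] by (simp add: set_eq_iff_mset_eq_distinct[symmetric])
  have bound: "f w \<le> N" if "w \<in> ?R" for w
    using agree_bounds(1)[OF cr(1)[OF that]] cr(2)[OF that] by (simp add: f_def N_def)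
  have up: "\<exists>w' \<in> ?R. move w w' \<and> f w' = Suc (f w)"
    if w: "w \<in> ?R" and unsorted: "\<not> sorted (map fst (crossings id w))" for w
  proof -
    have "value_inversions (id \<circ> word_perm w) = V"
      using R(2)[OF w] by (simp add: V_def)
    from ex_move_up[OF bij_id R(1)[OF w] this _ unsorted]
    obtain w' where "move w w'" "f w' = Suc (f w)"
      using avoids_312_value_inversions[OF assms] by (auto simp: f_def V_def)
    then show ?thesis using move_reduced_words[OF assms(1) w] by blast
  qed
  have down: "\<exists>w' \<in> ?R. move w w' \<and> f w = Suc (f w')"
    if w: "w \<in> ?R" and unsorted: "\<not> sorted (rev (map fst (crossings id w)))" for w
    using ex_move_down[OF R(1)[OF w] unsorted] move_reduced_words[OF assms(1) w]
    by (auto simp: f_def)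
  obtain w0 where w0: "w0 \<in> ?R" using reduced_words_nonempty[OF assms(1)] by blast
  \<comment> \<open>A global maximum of \<open>f\<close> admits no increasing move, hence is sorted.
    The library bound is strict, whence \<open>Suc N\<close>.\<close>
  obtain t where t: "t \<in> ?R" "\<And>w. w \<in> ?R \<Longrightarrow> f w \<le> f t"
    using ex_has_greatest_nat[of "\<lambda>w. w \<in> ?R" w0 f "Suc N"] w0 bound by (auto simp: less_Suc_eq_le)
  have t_sorted: "sorted (map fst (crossings id t))"
    using up[OF t(1)] t(2) by (metis Suc_n_not_le_n)
  obtain b where b: "b \<in> ?R" "\<And>w. w \<in> ?R \<Longrightarrow> f b \<le> f w"
    using ex_has_least_nat[of "\<lambda>w. w \<in> ?R" w0 f] w0 by auto
  have b_sorted: "sorted (rev (map fst (crossings id b)))"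
    using down[OF b(1)] b(2) by (metis Suc_n_not_le_n)
  \<comment> \<open>A multiset has one sorted listing, so the first components of the crossings
    agree, and they determine the word.\<close>
  have t_unique: "w = t" if "w \<in> ?R" "sorted (map fst (crossings id w))" for w
  proof (rule crossings_inject[OF inj_on_id])
    have "mset (map fst (crossings id w)) = mset (map fst (crossings id t))"
      using mset_eq[OF that(1) t(1)] by simp
    then show "map fst (crossings id w) = map fst (crossings id t)"
      using that(2) t_sorted by (metis properties_for_sort)
  qed
  have b_unique: "w = b" if "w \<in> ?R" "sorted (rev (map fst (crossings id w)))" for w
  proof (rule crossings_inject[OF inj_on_id])
    have "mset (rev (map fst (crossings id w))) = mset (rev (map fst (crossings id b)))"
      using mset_eq[OF that(1) b(1)] by simp
    then show "map fst (crossings id w) = map fst (crossings id b)"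
      using that(2) b_sorted by (metis properties_for_sort rev_rev_ident)
  qed
  have "diam ?G = ereal (real N)"
  proof (rule wf_digraph.diam_graded)
    show "wf_digraph ?G" by (rule wf_digraph_axioms)
    show "sym (arcs_ends ?G)" by (rule symI) (use move_sym arcs in blast)
    show "f w \<le> Suc (f u)" if "(u, w) \<in> arcs_ends ?G" for u w
      using that move_agree[of u w id] unfolding arcs f_def by blast
    show "f w \<le> N" if "w \<in> verts ?G" for w using that bound verts by blast
    show "t \<in> verts ?G" "b \<in> verts ?G" using t b verts by simp_all
    show "f t = N"
      using agree_bounds(2)[OF cr(1)[OF t(1)] t_sorted] cr(2)[OF t(1)] by (simp add: f_def N_def)
    show "f b = 0" using agree_eq_0[OF b_sorted] by (simp add: f_def)
    show "\<exists>w. (v, w) \<in> arcs_ends ?G \<and> f w = Suc (f v)" if "v \<in> verts ?G" "v \<noteq> t" for v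
      using that up[of v] t_unique[of v] unfolding verts arcs by blast
    show "\<exists>w. (v, w) \<in> arcs_ends ?G \<and> f v = Suc (f w)" if "v \<in> verts ?G" "v \<noteq> b" for v
      using that down[of v] b_unique[of v] unfolding verts arcs by blast
  qed
  then show ?thesis using card_indep_pairs[OF assms(1)] by (simp add: N_def V_def)
qed

end
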